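(* Let $d\ge 1$. (i) Let $\mathcal{H}\cong\mathbb{R}^{N}$ ($N\in\mathbb{N}$) be a finite-dimensional Hilbert space with the Euclidean inner product and let $(\phi_\omega)_{\omega\in\mathbb{R}^d}$ be a family of maps $\phi_\omega:\mathbb{R}^d\to\mathcal{H}$ such that $\omega\mapsto\langle\phi_\omega(x),\phi_\omega(y)\rangle_{\mathcal{H}}$ is integrable with respect to $\mathcal{N}(0,I_d)$ for all $x,y\in\mathbb{R}^d$. Then $$k(x,y):=\mathbb{E}_{\omega\sim\mathcal{N}(0,I_d)}\big[\langle \phi_\omega(x),\phi_\omega(y)\rangle_{\mathcal{H}}\big],\qquad x,y\in\mathbb{R}^d,$$ is a positive-definite kernel on $\mathbb{R}^d$. (ii) Conversely, for every positive-definite kernel $k:\mathbb{R}^d\times\mathbb{R}^d\to\mathbb{R}$ there exist a reproducing kernel Hilbert space $\mathcal{H}$ and maps $\phi_\omega:\mathbb{R}^d\to\mathcal{H}$, $\omega\in\mathbb{R}^d$, such that $k(x,y)=\mathbb{E}_{\omega\sim\mathcal{N}(0,I_d)}[\langle\phi_\omega(x),\phi_\omega(y)\rangle_{\mathcal{H}}]$ for all $x,y\in\mathbb{R}^d$.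
   Context: A positive-definite kernel on $\mathbb{R}^d$ is a symmetric function $k:\mathbb{R}^d\times\mathbb{R}^d\to\mathbb{R}$ such that $\sum_{i,j=1}^n c_ic_jk(x_i,x_j)\ge 0$ for all $n\in\mathbb{N}$, $c_1,\dots,c_n\in\mathbb{R}$ and $x_1,\dots,x_n\in\mathbb{R}^d$. *)

theory Defs
  imports "HOL-Probability.Probability"
begin

definition positive_definite_kernel :: "('a \<Rightarrow> 'a \<Rightarrow> real) \<Rightarrow> bool" where
  "positive_definite_kernel k \<longleftrightarrow>
     (\<forall>x y. k x y = k y x) \<and>
     (\<forall>(n::nat) (c::nat \<Rightarrow> real) (x::nat \<Rightarrow> 'a).
        (\<Sum>i<n. \<Sum>j<n. c i * c j * k (x i) (x j)) \<ge> 0)"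

text \<open>The standard normal distribution \<open>N(0, I\<^sub>d)\<close> with \<open>d = CARD('d)\<close>: the identity covariance
  makes its Lebesgue density the product of the one-dimensional standard normal densities.\<close>

definition std_gaussian :: "(real ^ 'd) measure" where
  "std_gaussian = density lborel (\<lambda>\<omega>. ennreal (\<Prod>i\<in>UNIV. std_normal_density (\<omega> $ i)))"

text \<open>Hilbert spaces of real functions on \<open>'a\<close> are given by a carrier \<open>H\<close>, with pointwise
  operations, and an inner product \<open>ip\<close> of which only the values on \<open>H\<close> matter.\<close>

definition function_inner_space ::
    "('a \<Rightarrow> real) set \<Rightarrow> (('a \<Rightarrow> real) \<Rightarrow> ('a \<Rightarrow> real) \<Rightarrow> real) \<Rightarrow> bool" where
  "function_inner_space H ip \<longleftrightarrow>
     (\<lambda>x. 0) \<in> H \<and>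
     (\<forall>f\<in>H. \<forall>g\<in>H. (\<lambda>x. f x + g x) \<in> H) \<and>
     (\<forall>a. \<forall>f\<in>H. (\<lambda>x. a * f x) \<in> H) \<and>
     (\<forall>f\<in>H. \<forall>g\<in>H. ip f g = ip g f) \<and>
     (\<forall>f\<in>H. \<forall>g\<in>H. \<forall>h\<in>H. ip (\<lambda>x. f x + g x) h = ip f h + ip g h) \<and>
     (\<forall>a. \<forall>f\<in>H. \<forall>g\<in>H. ip (\<lambda>x. a * f x) g = a * ip f g) \<and>
     (\<forall>f\<in>H. f \<noteq> (\<lambda>x. 0) \<longrightarrow> ip f f > 0)"

definition ip_norm :: "(('a \<Rightarrow> real) \<Rightarrow> ('a \<Rightarrow> real) \<Rightarrow> real) \<Rightarrow> ('a \<Rightarrow> real) \<Rightarrow> real" where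
  "ip_norm ip f = sqrt (ip f f)"

definition function_hilbert_space ::
    "('a \<Rightarrow> real) set \<Rightarrow> (('a \<Rightarrow> real) \<Rightarrow> ('a \<Rightarrow> real) \<Rightarrow> real) \<Rightarrow> bool" where
  "function_hilbert_space H ip \<longleftrightarrow>
     function_inner_space H ip \<and>
     (\<forall>F::nat \<Rightarrow> 'a \<Rightarrow> real.
        range F \<subseteq> H \<and>
        (\<forall>e>0. \<exists>M. \<forall>m\<ge>M. \<forall>n\<ge>M. ip_norm ip (\<lambda>x. F m x - F n x) < e) \<longrightarrow>
        (\<exists>f\<in>H. (\<lambda>n. ip_norm ip (\<lambda>x. F n x - f x)) \<longlonglongrightarrow> 0))"

text \<open>The last conjunct says that every point evaluation is a bounded linear functional.\<close>

definition rkhs ::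
    "('a \<Rightarrow> real) set \<Rightarrow> (('a \<Rightarrow> real) \<Rightarrow> ('a \<Rightarrow> real) \<Rightarrow> real) \<Rightarrow> bool" where
  "rkhs H ip \<longleftrightarrow>
     function_hilbert_space H ip \<and>
     (\<forall>x. \<exists>C. \<forall>f\<in>H. \<bar>f x\<bar> \<le> C * ip_norm ip f)"

end

(* For (ii) take the constant family "phi omega x = k x" in the Moore-Aronszajn space of k.
   For a finite combination l of point masses, let l(f) be its pairing with f and Q(l) its kernel
   energy. Put N(f) = sup over l of 2 l(f) - Q(l), and let H be the set of f with N(f) finite.
   Since (l, m) |-> ((l + m)/2, (l - m)/2) is a bijection, N satisfies the parallelogram law, so
   it comes from an inner product (Jordan-von Neumann). As a supremum of pointwise continuous
   functionals, N is lower semicontinuous under pointwise convergence, which gives completeness. *)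
theory Submission
  imports Defs
begin

text \<open>Total mass one makes the expectation of a family constant in \<open>\<omega>\<close>
  equal to that constant. The density is a product over coordinates, so its integral factors into
  one-dimensional ones.\<close>

lemma prob_space_std_gaussian: "prob_space (std_gaussian :: (real ^ 'd) measure)"
proof
  let ?f = "\<lambda>b::real^'d. \<lambda>t. ennreal (std_normal_density t)"
  have one: "(\<integral>\<^sup>+t. ennreal (std_normal_density t) \<partial>lborel) = 1"
    using prob_space.emeasure_space_1[OF prob_space_normal_density[of 1 0]]
    by (simp add: emeasure_density)
  have axes: "(\<Prod>b\<in>Basis. ?f b (\<omega> \<bullet> b)) = ennreal (\<Prod>i\<in>UNIV. std_normal_density (\<omega> $ i))"
    for \<omega> :: "real^'d"
  proof -
    have B: "(Basis :: (real^'d) set) = (\<lambda>i. axis i 1) ` UNIV"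
      by (auto simp: Basis_vec_def)
    have inj: "inj (\<lambda>i::'d. axis i (1::real))"
      by (auto simp: inj_on_def axis_eq_axis)
    show ?thesis
      unfolding B by (subst prod.reindex[OF inj]) (simp add: prod_ennreal inner_axis)
  qed
  have "(\<integral>\<^sup>+\<omega>. (\<Prod>b\<in>Basis. ?f b (\<omega> \<bullet> b)) \<partial>lborel)
      = (\<Prod>b\<in>(Basis::(real^'d) set). (\<integral>\<^sup>+t. ?f b t \<partial>lborel))"
    by (rule nn_integral_lborel_prod) auto
  then have "(\<integral>\<^sup>+\<omega>. ennreal (\<Prod>i\<in>UNIV. std_normal_density (\<omega> $ i))
      \<partial>(lborel :: (real^'d) measure)) = 1"
    by (simp only: axes one prod.neutral_const)
  moreover have "(\<lambda>\<omega>::real^'d. ennreal (\<Prod>i\<in>UNIV. std_normal_density (\<omega> $ i)))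
      \<in> borel_measurable lborel"
    by measurable
  ultimately show "emeasure (std_gaussian :: (real^'d) measure) (space std_gaussian) = 1"
    by (simp add: std_gaussian_def emeasure_density)
qed

text \<open>By linearity the quadratic form is the integral of the squared norm of a linear
  combination of features, whatever the measure.\<close>

lemma positive_definite_kernel_integral:
  fixes \<phi> :: "'w \<Rightarrow> 'a \<Rightarrow> 'h::real_inner"
  assumes int: "\<And>x y. integrable M (\<lambda>\<omega>. \<phi> \<omega> x \<bullet> \<phi> \<omega> y)"
  shows "positive_definite_kernel (\<lambda>x y. LINT \<omega>|M. \<phi> \<omega> x \<bullet> \<phi> \<omega> y)"
  unfolding positive_definite_kernel_def
proof (intro conjI allI)
  fix x y
  show "(LINT \<omega>|M. \<phi> \<omega> x \<bullet> \<phi> \<omega> y) = (LINT \<omega>|M. \<phi> \<omega> y \<bullet> \<phi> \<omega> x)"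
    by (simp add: inner_commute)
next
  fix n and c :: "nat \<Rightarrow> real" and x :: "nat \<Rightarrow> 'a"
  have "(\<Sum>i<n. \<Sum>j<n. c i * c j * (LINT \<omega>|M. \<phi> \<omega> (x i) \<bullet> \<phi> \<omega> (x j)))
      = (LINT \<omega>|M. (\<Sum>i<n. \<Sum>j<n. c i * c j * (\<phi> \<omega> (x i) \<bullet> \<phi> \<omega> (x j))))"
    using int by (simp add: Bochner_Integration.integral_sum)
  also have "\<dots> = (LINT \<omega>|M. (\<Sum>i<n. c i *\<^sub>R \<phi> \<omega> (x i)) \<bullet> (\<Sum>j<n. c j *\<^sub>R \<phi> \<omega> (x j)))"
    unfolding inner_sum_left by (simp add: inner_sum_right sum_distrib_left mult.assoc mult.left_commute)
  also have "\<dots> \<ge> 0"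
    by (rule Bochner_Integration.integral_nonneg) simp
  finally show "0 \<le> (\<Sum>i<n. \<Sum>j<n. c i * c j * (LINT \<omega>|M. \<phi> \<omega> (x i) \<bullet> \<phi> \<omega> (x j)))" .
qed

text \<open>Subtracting \<open>a * h 1\<close> leaves an additive \<open>r\<close> that vanishes on
  the integers, hence is 1-periodic and bounded; \<open>r (n * a) = n * r a\<close> then forces
  \<open>r = 0\<close>. This later yields homogeneity of \<open>ip\<close>.\<close>

lemma additive_bounded_imp_linear:
  fixes h :: "real \<Rightarrow> real"
  assumes add: "\<And>a b. h (a + b) = h a + h b"
    and bound: "\<And>a. \<bar>a\<bar> \<le> 1 \<Longrightarrow> \<bar>h a\<bar> \<le> C"
  shows "h a = a * h 1"
proof -
  define r where "r a = h a - a * h 1" for a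
  have r_add: "r (a + b) = r a + r b" for a b
    by (simp add: r_def add algebra_simps)
  have r1: "r 1 = 0" by (simp add: r_def)
  interpret r: additive r by unfold_locales (rule r_add)
  have r_mult: "r (of_nat n * a) = of_nat n * r a" for n a
    by (induction n) (simp_all add: r_add r.zero algebra_simps)
  have r_int: "r (of_int m) = 0" for m
    by (cases m rule: int_cases2) (use r_mult[of _ 1] in \<open>simp_all add: r1 r.minus\<close>)
  have r_bounded: "\<bar>r a\<bar> \<le> C + \<bar>h 1\<bar>" for a
  proof -
    have "r a = r (frac a)"
      using r_add[of "of_int \<lfloor>a\<rfloor>" "frac a"] by (simp add: r_int frac_def)
    moreover have f: "0 \<le> frac a" "frac a < 1"
      by (simp_all add: frac_lt_1)
    moreover have "\<bar>frac a * h 1\<bar> \<le> 1 * \<bar>h 1\<bar>"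
      unfolding abs_mult using f by (intro mult_right_mono) auto
    ultimately show ?thesis
      using bound[of "frac a"] by (simp add: r_def)
  qed
  have "r a = 0"
  proof (rule ccontr)
    assume "r a \<noteq> 0"
    then obtain n where "C + \<bar>h 1\<bar> < of_nat n * \<bar>r a\<bar>"
      using reals_Archimedean3[of "\<bar>r a\<bar>"] by auto
    with r_bounded[of "of_nat n * a"] show False
      by (simp add: r_mult abs_mult)
  qed
  then show ?thesis by (simp add: r_def)
qed

section \<open>Finite combinations of point masses\<close>

text \<open>A list of pairs \<open>(c, x)\<close> stands for the functional \<open>f \<mapsto> \<Sum> c * f x\<close>, so that concatenation
  is addition.\<close>

definition pairing :: "(real \<times> 'a) list \<Rightarrow> ('a \<Rightarrow> real) \<Rightarrow> real" where
  "pairing l f = (\<Sum>(c, x)\<leftarrow>l. c * f x)"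

definition scale_comb :: "real \<Rightarrow> (real \<times> 'a) list \<Rightarrow> (real \<times> 'a) list" where
  "scale_comb a l = map (\<lambda>(c, x). (a * c, x)) l"

lemma pairing_Nil [simp]: "pairing [] f = 0"
  and pairing_Cons [simp]: "pairing ((c, x) # l) f = c * f x + pairing l f"
  and pairing_append [simp]: "pairing (l @ m) f = pairing l f + pairing m f"
  by (simp_all add: pairing_def)

lemma pairing_scale_comb [simp]: "pairing (scale_comb a l) f = a * pairing l f"
  by (induction l) (auto simp: scale_comb_def algebra_simps)

lemma pairing_add [simp]: "pairing l (\<lambda>x. f x + g x) = pairing l f + pairing l g"
  by (induction l) (auto simp: algebra_simps)

lemma pairing_diff [simp]: "pairing l (\<lambda>x. f x - g x) = pairing l f - pairing l g"
  by (induction l) (auto simp: algebra_simps)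

lemma pairing_mult [simp]: "pairing l (\<lambda>x. a * f x) = a * pairing l f"
  by (induction l) (auto simp: algebra_simps)

lemma pairing_zero [simp]: "pairing l (\<lambda>x. 0) = 0"
  by (induction l) auto

lemma pairing_swap: "pairing l (\<lambda>x. pairing m (h x)) = pairing m (\<lambda>y. pairing l (\<lambda>x. h x y))"
  by (induction l) auto

lemma tendsto_pairing:
  assumes "\<And>x. (\<lambda>n. F n x) \<longlonglongrightarrow> f x"
  shows "(\<lambda>n. pairing l (F n)) \<longlonglongrightarrow> pairing l f"
  by (induction l) (auto intro!: tendsto_intros assms)

section \<open>The Moore-Aronszajn space of a kernel\<close>

locale pd_kernel =
  fixes k :: "'a \<Rightarrow> 'a \<Rightarrow> real"
  assumes pd: "positive_definite_kernel k"
begin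

lemma sym: "k x y = k y x"
  using pd by (auto simp: positive_definite_kernel_def)

definition Q :: "(real \<times> 'a) list \<Rightarrow> (real \<times> 'a) list \<Rightarrow> real" where
  "Q l m = pairing l (\<lambda>x. pairing m (k x))"

lemma Q_sym: "Q l m = Q m l"
  unfolding Q_def by (subst pairing_swap) (simp add: sym)

lemma Q_simps [simp]:
  "Q [] m = 0" "Q l [] = 0"
  "Q (l @ l') m = Q l m + Q l' m" "Q l (m @ m') = Q l m + Q l m'"
  "Q (scale_comb a l) m = a * Q l m" "Q l (scale_comb a m) = a * Q l m"
  by (simp_all add: Q_def)

lemma Q_nonneg: "0 \<le> Q l l"
proof -
  have "pairing m f = (\<Sum>i<length m. fst (m ! i) * f (snd (m ! i)))" for m and f :: "'a \<Rightarrow> real"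
    by (simp add: pairing_def sum_list_sum_nth atLeast0LessThan case_prod_beta)
  then have "Q l l = (\<Sum>i<length l. \<Sum>j<length l.
      fst (l ! i) * fst (l ! j) * k (snd (l ! i)) (snd (l ! j)))"
    by (simp add: Q_def sum_distrib_left mult.assoc)
  also have "\<dots> \<ge> 0"
    by (rule pd[unfolded positive_definite_kernel_def, THEN conjunct2, rule_format])
  finally show ?thesis .
qed

text \<open>In a Hilbert space with reproducing kernel \<open>k\<close> this is
  \<open>||f||^2 - ||f - g||^2\<close>, where \<open>g\<close> is the combination of kernel sections
  given by \<open>l\<close>. Such \<open>g\<close> are dense, so the supremum over \<open>l\<close>
  is \<open>||f||^2\<close>.\<close>

definition V :: "(real \<times> 'a) list \<Rightarrow> ('a \<Rightarrow> real) \<Rightarrow> real" where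
  "V l f = 2 * pairing l f - Q l l"

definition H :: "('a \<Rightarrow> real) set" where
  "H = {f. bdd_above (range (\<lambda>l. V l f))}"

text \<open>A supremum in the reals, meaningful only for \<open>f\<close> in \<open>H\<close>; hence
  the membership hypotheses below.\<close>

definition N :: "('a \<Rightarrow> real) \<Rightarrow> real" where
  "N f = (SUP l. V l f)"

definition ip :: "('a \<Rightarrow> real) \<Rightarrow> ('a \<Rightarrow> real) \<Rightarrow> real" where
  "ip f g = (N (\<lambda>x. f x + g x) - N (\<lambda>x. f x - g x)) / 4"

section \<open>The squared norm and its parallelogram law\<close>

lemma V_Nil [simp]: "V [] f = 0"
  by (simp add: V_def)

lemma V_le_N: "f \<in> H \<Longrightarrow> V l f \<le> N f"
  unfolding H_def N_def by (auto intro: cSUP_upper)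

lemma in_HI: "(\<And>l. V l f \<le> C) \<Longrightarrow> f \<in> H"
  unfolding H_def by (auto intro: bdd_aboveI2[where M = C])

lemma N_le: "(\<And>l. V l f \<le> C) \<Longrightarrow> N f \<le> C"
  unfolding N_def by (auto intro: cSUP_least)

lemma N_nonneg: "f \<in> H \<Longrightarrow> 0 \<le> N f"
  using V_le_N[of f "[]"] by simp

lemma zero_in_H: "(\<lambda>x. 0) \<in> H" and N_zero: "N (\<lambda>x. 0) = 0"
proof -
  have V: "V l (\<lambda>x. 0) \<le> 0" for l
    using Q_nonneg[of l] by (simp add: V_def)
  show zero: "(\<lambda>x. 0) \<in> H" by (rule in_HI[OF V])
  show "N (\<lambda>x. 0) = 0"
    using N_le[OF V] N_nonneg[OF zero] by simp
qed

text \<open>Rescaling the combination absorbs the scalar, which makes the supremum homogeneous of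
  degree two.\<close>

lemma V_mult:
  assumes "a \<noteq> 0"
  shows "V l (\<lambda>x. a * f x) = a\<^sup>2 * V (scale_comb (1 / a) l) f"
  using assms by (simp add: V_def field_simps power2_eq_square)

lemma mult_in_H:
  assumes "f \<in> H"
  shows "(\<lambda>x. a * f x) \<in> H"
proof (cases "a = 0")
  case False
  have "V l (\<lambda>x. a * f x) \<le> a\<^sup>2 * N f" for l
    unfolding V_mult[OF \<open>a \<noteq> 0\<close>] by (intro mult_left_mono V_le_N assms) simp
  then show ?thesis by (rule in_HI)
qed (simp add: zero_in_H)

lemma N_mult:
  assumes f: "f \<in> H"
  shows "N (\<lambda>x. a * f x) = a\<^sup>2 * N f"
proof (cases "a = 0")
  case False
  have le: "N (\<lambda>x. b * g x) \<le> b\<^sup>2 * N g" if "g \<in> H" "b \<noteq> 0" for b g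
    using that by (auto intro!: N_le mult_left_mono V_le_N simp: V_mult)
  \<comment> \<open>The reverse inequality is the same bound for \<open>a * f\<close> and the scalar
    \<open>1 / a\<close>.\<close>
  have "N f \<le> (1 / a)\<^sup>2 * N (\<lambda>x. a * f x)"
    using le[OF mult_in_H[OF f, of a], of "1 / a"] False by simp
  then have "a\<^sup>2 * N f \<le> N (\<lambda>x. a * f x)"
    using False by (simp add: field_simps)
  with le[OF f False] show ?thesis by simp
qed (simp add: N_zero)

text \<open>The cross terms \<open>Q l m\<close> cancel between half sum and half difference, whose
  energies add up to half of \<open>Q l l + Q m m\<close>.\<close>

lemma V_parallelogram:
  "V l (\<lambda>x. f x + g x) + V m (\<lambda>x. f x - g x)
    = 2 * V (scale_comb (1/2) (l @ m)) f + 2 * V (scale_comb (1/2) (l @ scale_comb (-1) m)) g"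
  by (simp add: V_def Q_sym[of m l] field_simps)

lemma V_parallelogram_le:
  assumes "f \<in> H" "g \<in> H"
  shows "V l (\<lambda>x. f x + g x) + V m (\<lambda>x. f x - g x) \<le> 2 * N f + 2 * N g"
  unfolding V_parallelogram
  by (intro add_mono mult_left_mono V_le_N assms) auto

text \<open>The empty combination in the second slot turns the parallelogram bound into a bound for
  the sum alone.\<close>

lemma add_in_H: "f \<in> H \<Longrightarrow> g \<in> H \<Longrightarrow> (\<lambda>x. f x + g x) \<in> H"
  using V_parallelogram_le[of f g _ "[]"] by (intro in_HI[of _ "2 * N f + 2 * N g"]) simp

lemma diff_in_H: "f \<in> H \<Longrightarrow> g \<in> H \<Longrightarrow> (\<lambda>x. f x - g x) \<in> H"
  using add_in_H[OF _ mult_in_H[of g "-1"]] by simp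

text \<open>Since \<open>l\<close> and \<open>m\<close> vary independently, the two suprema can be
  taken one after the other.\<close>

lemma N_parallelogram_le:
  assumes "f \<in> H" "g \<in> H"
  shows "N (\<lambda>x. f x + g x) + N (\<lambda>x. f x - g x) \<le> 2 * N f + 2 * N g"
proof -
  let ?K = "2 * N f + 2 * N g"
  have "N (\<lambda>x. f x + g x) \<le> ?K - V m (\<lambda>x. f x - g x)" for m
    using V_parallelogram_le[OF assms, of _ m] by (intro N_le) (simp add: le_diff_eq)
  then have "N (\<lambda>x. f x - g x) \<le> ?K - N (\<lambda>x. f x + g x)"
    by (intro N_le) (simp add: algebra_simps)
  then show ?thesis by simp
qed

text \<open>The converse inequality is the same bound applied to \<open>f + g\<close> and
  \<open>f - g\<close>, whose sum and difference are \<open>2 * f\<close> and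
  \<open>2 * g\<close>.\<close>

lemma N_parallelogram:
  assumes f: "f \<in> H" and g: "g \<in> H"
  shows "N (\<lambda>x. f x + g x) + N (\<lambda>x. f x - g x) = 2 * N f + 2 * N g"
  using N_parallelogram_le[OF f g] N_parallelogram_le[OF add_in_H[OF f g] diff_in_H[OF f g]]
    N_mult[OF f, of 2] N_mult[OF g, of 2]
  by (simp add: mult_2[symmetric])

lemma N_diff_commute:
  assumes "f \<in> H" "g \<in> H"
  shows "N (\<lambda>x. f x - g x) = N (\<lambda>x. g x - f x)"
  using N_mult[OF diff_in_H[OF assms], of "-1"] by simp

section \<open>The inner product by polarization\<close>

lemma ip_self: "f \<in> H \<Longrightarrow> ip f f = N f"
  using N_mult[of f 2] by (simp add: ip_def N_zero mult_2[symmetric])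

lemma ip_commute: "f \<in> H \<Longrightarrow> g \<in> H \<Longrightarrow> ip f g = ip g f"
  using N_diff_commute[of f g] by (simp add: ip_def add.commute)

lemma ip_add_left:
  assumes f: "f \<in> H" and g: "g \<in> H" and h: "h \<in> H"
  shows "ip (\<lambda>x. f x + g x) h = ip f h + ip g h"
proof -
  \<comment> \<open>Subtracting the parallelogram laws for the pairs \<open>u + h, v\<close> and
    \<open>u - h, v\<close> cancels the terms in \<open>N v\<close>.\<close>
  have two: "ip (\<lambda>x. u x + v x) h + ip (\<lambda>x. u x - v x) h = 2 * ip u h"
    if "u \<in> H" "v \<in> H" for u v
    using N_parallelogram[OF add_in_H[OF that(1) h] that(2)]
      N_parallelogram[OF diff_in_H[OF that(1) h] that(2)]
    by (simp add: ip_def field_simps)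
  \<comment> \<open>Exchanging \<open>f\<close> and \<open>g\<close> flips the sign of the
    difference term, so adding both instances of \<open>two\<close> removes it.\<close>
  have "ip (\<lambda>x. g x - f x) h = - ip (\<lambda>x. f x - g x) h"
    using N_diff_commute[OF add_in_H[OF f h] g] N_diff_commute[OF add_in_H[OF g h] f]
    by (simp add: ip_def algebra_simps diff_divide_distrib)
  with two[OF f g] two[OF g f] show ?thesis
    by (simp add: add.commute)
qed

text \<open>The left side is additive in \<open>a\<close>, and the parallelogram law bounds it for
  \<open>\<bar>a\<bar> \<le> 1\<close>; together these force linearity.\<close>

lemma ip_mult_left:
  assumes f: "f \<in> H" and g: "g \<in> H"
  shows "ip (\<lambda>x. a * f x) g = a * ip f g"
proof -
  let ?h = "\<lambda>a. ip (\<lambda>x. a * f x) g"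
  have add: "?h (a + b) = ?h a + ?h b" for a b
    using ip_add_left[OF mult_in_H[OF f] mult_in_H[OF f] g, of a b]
    by (simp add: distrib_right)
  have bound: "\<bar>?h a\<bar> \<le> N f + N g" if "\<bar>a\<bar> \<le> 1" for a
  proof -
    note af = mult_in_H[OF f, of a]
    have "a\<^sup>2 * N f \<le> 1 * N f"
      using that N_nonneg[OF f] by (intro mult_right_mono) (auto simp: abs_square_le_1)
    then show ?thesis
      using N_parallelogram[OF af g] N_mult[OF f, of a] N_nonneg[OF f] N_nonneg[OF g]
        N_nonneg[OF add_in_H[OF af g]] N_nonneg[OF diff_in_H[OF af g]]
      unfolding ip_def abs_le_iff by argo
  qed
  show ?thesis
    using additive_bounded_imp_linear[of ?h, OF add bound] by simp
qed

section \<open>Point evaluations and completeness\<close>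

text \<open>Testing with a single mass \<open>t\<close> at \<open>x\<close> gives a quadratic
  inequality in \<open>t\<close>; optimizing over \<open>t\<close> gives this Cauchy-Schwarz
  bound.\<close>

lemma eval_square_le:
  assumes "f \<in> H"
  shows "(f x)\<^sup>2 \<le> k x x * N f"
proof -
  have V: "2 * t * f x - t\<^sup>2 * k x x \<le> N f" for t
    using V_le_N[OF assms, of "[(t, x)]"] by (simp add: V_def Q_def power2_eq_square)
  have kxx: "0 \<le> k x x"
    using Q_nonneg[of "[(1, x)]"] by (simp add: Q_def)
  show ?thesis
  proof (cases "k x x = 0")
    case True
    have "f x = 0"
    proof (rule ccontr)
      assume "f x \<noteq> 0"
      \<comment> \<open>Without a quadratic term, this \<open>t\<close> would give
        \<open>N f + 1 \<le> N f\<close>.\<close>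
      with V[of "(N f + 1) / (2 * f x)"] show False by (simp add: True)
    qed
    with True show ?thesis by simp
  next
    case False
    \<comment> \<open>This \<open>t\<close> is the vertex of the parabola.\<close>
    with kxx V[of "f x / k x x"] show ?thesis
      by (simp add: field_simps power2_eq_square)
  qed
qed

lemma eval_le:
  assumes "f \<in> H"
  shows "\<bar>f x\<bar> \<le> sqrt (k x x) * ip_norm ip f"
  using real_sqrt_le_mono[OF eval_square_le[OF assms, of x]]
  by (simp add: ip_norm_def ip_self[OF assms] real_sqrt_mult)

lemma function_inner_space_H: "function_inner_space H ip"
proof -
  have pos: "ip f f > 0" if f: "f \<in> H" and "f \<noteq> (\<lambda>x. 0)" for f
  proof -
    from \<open>f \<noteq> (\<lambda>x. 0)\<close> obtain x where "f x \<noteq> 0" by auto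
    then have "0 < k x x * N f"
      using eval_square_le[OF f, of x] by (meson less_le_trans zero_less_power2)
    with N_nonneg[OF f] show ?thesis
      by (simp add: ip_self[OF f] zero_less_mult_iff)
  qed
  show ?thesis
    unfolding function_inner_space_def
    by (intro conjI ballI allI impI zero_in_H add_in_H mult_in_H ip_commute ip_add_left
        ip_mult_left pos)
qed

lemma H_complete:
  fixes F :: "nat \<Rightarrow> 'a \<Rightarrow> real"
  assumes F: "range F \<subseteq> H"
    and Cauchy: "\<forall>e>0. \<exists>M. \<forall>m\<ge>M. \<forall>n\<ge>M. ip_norm ip (\<lambda>x. F m x - F n x) < e"
  shows "\<exists>f\<in>H. (\<lambda>n. ip_norm ip (\<lambda>x. F n x - f x)) \<longlonglongrightarrow> 0"
proof -
  have FH: "F n \<in> H" for n using F by auto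
  have diffH: "(\<lambda>x. F m x - F n x) \<in> H" for m n by (intro diff_in_H FH)
  have "Cauchy (\<lambda>n. F n x)" for x
  proof (rule metric_CauchyI)
    fix e :: real assume e: "e > 0"
    \<comment> \<open>Adding 1 keeps the divisor positive when \<open>k x x = 0\<close>.\<close>
    let ?s = "sqrt (k x x) + 1"
    have s: "?s > 0"
      using Q_nonneg[of "[(1, x)]"] by (simp add: Q_def add_nonneg_pos)
    then obtain M where M: "ip_norm ip (\<lambda>x. F m x - F n x) < e / ?s" if "m \<ge> M" "n \<ge> M" for m n
      using Cauchy e by (meson divide_pos_pos)
    have "dist (F m x) (F n x) < e" if "m \<ge> M" "n \<ge> M" for m n
    proof -
      have nn: "0 \<le> ip_norm ip (\<lambda>x. F m x - F n x)"
        by (simp add: ip_norm_def ip_self[OF diffH] N_nonneg[OF diffH])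
      have "\<bar>F m x - F n x\<bar> \<le> ?s * ip_norm ip (\<lambda>x. F m x - F n x)"
        using eval_le[OF diffH[of m n], of x] nn by (simp add: distrib_right)
      also have "\<dots> < e"
        using M[OF that] s by (simp add: field_simps)
      finally show ?thesis by (simp add: dist_real_def)
    qed
    then show "\<exists>M. \<forall>m\<ge>M. \<forall>n\<ge>M. dist (F m x) (F n x) < e" by blast
  qed
  then obtain f where f: "\<And>x. (\<lambda>n. F n x) \<longlonglongrightarrow> f x"
    unfolding Cauchy_convergent_iff convergent_def by metis
  \<comment> \<open>For fixed \<open>l\<close> the bound on \<open>F n - F m\<close> survives the
    pointwise limit in \<open>m\<close>. As \<open>M\<close> is chosen before \<open>l\<close>, it
    then bounds the supremum too.\<close>
  have close: "\<exists>M. \<forall>n\<ge>M. \<forall>l. V l (\<lambda>x. F n x - f x) \<le> e\<^sup>2" if "e > 0" for e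
  proof -
    obtain M where M: "ip_norm ip (\<lambda>x. F m x - F n x) < e" if "m \<ge> M" "n \<ge> M" for m n
      using Cauchy \<open>e > 0\<close> by meson
    have "V l (\<lambda>x. F n x - f x) \<le> e\<^sup>2" if n: "n \<ge> M" for n l
    proof (rule tendsto_upperbound)
      show "(\<lambda>m. V l (\<lambda>x. F n x - F m x)) \<longlonglongrightarrow> V l (\<lambda>x. F n x - f x)"
        unfolding V_def by (intro tendsto_intros tendsto_pairing f)
      have "V l (\<lambda>x. F n x - F m x) \<le> e\<^sup>2" if "m \<ge> M" for m
      proof -
        have "sqrt (N (\<lambda>x. F n x - F m x)) < e"
          using M[OF n that] by (simp add: ip_norm_def ip_self[OF diffH])
        then have "N (\<lambda>x. F n x - F m x) \<le> e\<^sup>2"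
          using \<open>e > 0\<close> by (metis less_imp_le real_sqrt_le_iff real_sqrt_unique)
        with V_le_N[OF diffH] show ?thesis by (rule order_trans)
      qed
      then show "\<forall>\<^sub>F m in sequentially. V l (\<lambda>x. F n x - F m x) \<le> e\<^sup>2"
        by (auto simp: eventually_sequentially)
    qed simp
    then show ?thesis by blast
  qed
  \<comment> \<open>One such difference puts \<open>f\<close> in \<open>H\<close>, because
    \<open>f = F n - (F n - f)\<close>.\<close>
  obtain n where "(\<lambda>x. F n x - f x) \<in> H"
    using close[of 1] in_HI by (metis order_refl zero_less_one)
  from diff_in_H[OF FH this, of n] have fH: "f \<in> H" by simp
  have "(\<lambda>n. ip_norm ip (\<lambda>x. F n x - f x)) \<longlonglongrightarrow> 0"
  proof (rule metric_LIMSEQ_I)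
    fix e :: real assume e: "e > 0"
    \<comment> \<open>Halving \<open>e\<close> restores strictness, since a supremum inherits only a
      non-strict bound.\<close>
    then obtain M where M: "\<And>n l. n \<ge> M \<Longrightarrow> V l (\<lambda>x. F n x - f x) \<le> (e / 2)\<^sup>2"
      using close[of "e / 2"] by auto
    have "dist (ip_norm ip (\<lambda>x. F n x - f x)) 0 < e" if "n \<ge> M" for n
    proof -
      note dH = diff_in_H[OF FH fH, of n]
      have "sqrt (N (\<lambda>x. F n x - f x)) \<le> e / 2"
        using e by (intro real_le_lsqrt N_le[OF M[OF that]]) simp
      with e N_nonneg[OF dH] show ?thesis
        by (simp add: ip_norm_def ip_self[OF dH])
    qed
    then show "\<exists>M. \<forall>n\<ge>M. dist (ip_norm ip (\<lambda>x. F n x - f x)) 0 < e" by blast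
  qed
  with fH show ?thesis by blast
qed

lemma rkhs_H: "rkhs H ip"
  unfolding rkhs_def function_hilbert_space_def
  using function_inner_space_H H_complete eval_le by blast

section \<open>Kernel sections and the reproduced kernel\<close>

text \<open>Nonnegativity of the energy of \<open>m - l\<close> bounds \<open>V l\<close> by
  \<open>Q m m\<close>, and \<open>l = m\<close> attains the bound.\<close>

lemma pairing_kernel_in_H: "(\<lambda>x. pairing m (k x)) \<in> H"
  and N_pairing_kernel: "N (\<lambda>x. pairing m (k x)) = Q m m"
proof -
  have V: "V l (\<lambda>x. pairing m (k x)) \<le> Q m m" for l
    using Q_nonneg[of "m @ scale_comb (-1) l"] Q_sym[of l m]
    by (simp add: V_def Q_def[symmetric])
  show H: "(\<lambda>x. pairing m (k x)) \<in> H" by (rule in_HI[OF V])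
  show "N (\<lambda>x. pairing m (k x)) = Q m m"
    using N_le[OF V] V_le_N[OF H, of m] by (simp add: V_def Q_def[symmetric])
qed

lemma kernel_in_H: "k x \<in> H"
proof -
  have "(\<lambda>y. k y x) = k x"
    by (rule ext) (rule sym)
  with pairing_kernel_in_H[of "[(1, x)]"] show ?thesis by simp
qed

lemma ip_kernel: "ip (k x) (k y) = k x y"
proof -
  have eq: "k x = (\<lambda>z. k z x)" "k y = (\<lambda>z. k z y)"
    by (rule ext, rule sym)+
  \<comment> \<open>The sum and difference of the two sections come from two-mass combinations,
    whose energies differ by \<open>4 * k x y\<close>.\<close>
  have "ip (k x) (k y) = (Q [(1, x), (1, y)] [(1, x), (1, y)]
      - Q [(1, x), (-1, y)] [(1, x), (-1, y)]) / 4"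
    unfolding ip_def N_pairing_kernel[symmetric] by (subst (1 2) eq(1), subst (1 2) eq(2)) simp
  then show ?thesis
    using sym[of y x] by (simp add: Q_def)
qed

end

text \<open>Part (ii) asserts integrability explicitly, because the Bochner integral of a
  non-integrable function is 0 by convention.\<close>

theorem proposition1:
  shows "(\<forall>\<phi> :: real ^ 'd \<Rightarrow> real ^ 'd \<Rightarrow> 'h::euclidean_space.
            (\<forall>x y. integrable std_gaussian (\<lambda>\<omega>. inner (\<phi> \<omega> x) (\<phi> \<omega> y))) \<longrightarrow>
            positive_definite_kernel
              (\<lambda>x y. LINT \<omega>|std_gaussian. inner (\<phi> \<omega> x) (\<phi> \<omega> y)))
       \<and> (\<forall>k :: real ^ 'd \<Rightarrow> real ^ 'd \<Rightarrow> real.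
            positive_definite_kernel k \<longrightarrow>
            (\<exists>(H :: (real ^ 'd \<Rightarrow> real) set) ip (\<phi> :: real ^ 'd \<Rightarrow> real ^ 'd \<Rightarrow> (real ^ 'd \<Rightarrow> real)).
               rkhs H ip \<and>
               (\<forall>\<omega> x. \<phi> \<omega> x \<in> H) \<and>
               (\<forall>x y. integrable std_gaussian (\<lambda>\<omega>. ip (\<phi> \<omega> x) (\<phi> \<omega> y)) \<and>
                      k x y = (LINT \<omega>|std_gaussian. ip (\<phi> \<omega> x) (\<phi> \<omega> y)))))"
proof (intro conjI allI impI)
  fix \<phi> :: "real ^ 'd \<Rightarrow> real ^ 'd \<Rightarrow> 'h"
  assume "\<forall>x y. integrable std_gaussian (\<lambda>\<omega>. inner (\<phi> \<omega> x) (\<phi> \<omega> y))"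
  then show "positive_definite_kernel
      (\<lambda>x y. LINT \<omega>|std_gaussian. inner (\<phi> \<omega> x) (\<phi> \<omega> y))"
    by (intro positive_definite_kernel_integral) blast
next
  fix k :: "real ^ 'd \<Rightarrow> real ^ 'd \<Rightarrow> real"
  assume "positive_definite_kernel k"
  then interpret pd_kernel k by unfold_locales
  interpret prob_space "std_gaussian :: (real ^ 'd) measure"
    by (rule prob_space_std_gaussian)
  show "\<exists>(H :: (real ^ 'd \<Rightarrow> real) set) ip (\<phi> :: real ^ 'd \<Rightarrow> real ^ 'd \<Rightarrow> (real ^ 'd \<Rightarrow> real)).
      rkhs H ip \<and> (\<forall>\<omega> x. \<phi> \<omega> x \<in> H) \<and>
      (\<forall>x y. integrable std_gaussian (\<lambda>\<omega>. ip (\<phi> \<omega> x) (\<phi> \<omega> y)) \<and>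
             k x y = (LINT \<omega>|std_gaussian. ip (\<phi> \<omega> x) (\<phi> \<omega> y)))"
    by (rule exI[of _ H], rule exI[of _ ip], rule exI[of _ "\<lambda>_. k"])
      (simp add: rkhs_H kernel_in_H ip_kernel prob_space)
qed

end
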